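(* Let $\lambda,\gamma\in\mathbb{N}_0$ with $(\lambda,\gamma)\neq(0,0)$ and $\beta\in\mathbb{N}$ (positive integer), and let $H_n(\lambda,\beta,\gamma)$ denote the coefficient of $\frac{x^n}{n!}$ in $\frac{e^{\gamma x}}{(2-e^{\beta x})^{\lambda}}$. Then for every $n\in\mathbb{N}_0$, $H_n(\lambda,\beta,\gamma)$ equals the number of barred preferential arrangements of $X_n=\{1,\dots,n\}$ with $\lambda$ bars (hence $\lambda+1$ sections) such that the first section has the property that its elements are distributed into $\gamma$ labelled compartments (each of its elements receives a label from $\{1,\dots,\gamma\}$; the section may be empty), and each of the remaining $\lambda$ sections is a (possibly empty) preferential arrangement whose blocks each have $\beta$ labelled compartments (each element of such a section receives a label from $\{1,\dots,\beta\}$).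
   Context: A preferential arrangement of a finite set is an ordered set partition (a sequence of non-empty disjoint blocks whose union is the set). A barred preferential arrangement of $X_n$ with $\xi$ bars consists of $\xi$ identical bars creating $\xi+1$ ordered sections, the elements of $X_n$ being distributed among the sections and each section carrying a (possibly empty) preferential arrangement of its elements. Convention $0^0=1$. *)

theory Defs
  imports "HOL-Library.FuncSet" "HOL-Library.Disjoint_Sets"
    "HOL-Computational_Algebra.Formal_Power_Series"
begin

definition preferential_arrangements :: "'a set \<Rightarrow> 'a set list set" where
  "preferential_arrangements A = {bs. distinct bs \<and> partition_on A (set bs)}"

text \<open>
  The bars are identical, so placing \<open>k\<close> of them amounts to distributing the elements among
  \<open>k + 1\<close> ordered sections, any of which may be empty.
\<close>

definition barred_sections :: "nat \<Rightarrow> 'a set \<Rightarrow> 'a set list set" where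
  "barred_sections k X =
     {S. length S = Suc k \<and> disjoint_family_on (\<lambda>i. S ! i) {..<Suc k} \<and> \<Union>(set S) = X}"

text \<open>
  Here \<open>F0 A\<close> is the set of structures that the first section may carry if its elements form the
  set \<open>A\<close>, and \<open>F A\<close> plays the same role for each of the other sections.
\<close>

definition barred_arrangements ::
  "('a set \<Rightarrow> 'c set) \<Rightarrow> ('a set \<Rightarrow> 'd set) \<Rightarrow> nat \<Rightarrow> 'a set \<Rightarrow> ('a set list \<times> 'c \<times> 'd list) set" where
  "barred_arrangements F0 F k X =
     {(S, s0, ss). S \<in> barred_sections k X \<and> s0 \<in> F0 (S ! 0) \<and>
        length ss = k \<and> (\<forall>i<k. ss ! i \<in> F (S ! Suc i))}"

text \<open>Ordinary barred preferential arrangements, for comparison with the labelled variant below.\<close>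

definition barred_preferential_arrangements ::
  "nat \<Rightarrow> 'a set \<Rightarrow> ('a set list \<times> 'a set list \<times> 'a set list list) set" where
  "barred_preferential_arrangements =
     barred_arrangements preferential_arrangements preferential_arrangements"

text \<open>
  Distributing the elements of \<open>A\<close> into \<open>m\<close> labelled (possibly empty) compartments means giving
  every element a label. If each block of a preferential arrangement of \<open>A\<close> has \<open>m\<close> such
  compartments, the choices made in the blocks together form a single labelling of \<open>A\<close>.
\<close>

definition compartment_labellings :: "nat \<Rightarrow> 'a set \<Rightarrow> ('a \<Rightarrow> nat) set" where
  "compartment_labellings m A = (A \<rightarrow>\<^sub>E {1..m})"

definition labelled_preferential_arrangements ::
  "nat \<Rightarrow> 'a set \<Rightarrow> ('a set list \<times> ('a \<Rightarrow> nat)) set" where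
  "labelled_preferential_arrangements m A =
     preferential_arrangements A \<times> compartment_labellings m A"

text \<open>The first section carries only a labelling of its elements, with no ordered blocks.\<close>

definition labelled_barred_preferential_arrangements ::
  "nat \<Rightarrow> nat \<Rightarrow> nat \<Rightarrow> 'a set \<Rightarrow>
     ('a set list \<times> ('a \<Rightarrow> nat) \<times> ('a set list \<times> ('a \<Rightarrow> nat)) list) set" where
  "labelled_barred_preferential_arrangements l b g =
     barred_arrangements (compartment_labellings g) (labelled_preferential_arrangements b) l"

text \<open>
  The denominator has constant coefficient \<open>1\<close>, so the division is genuine division by a unit.
\<close>

definition H :: "nat \<Rightarrow> nat \<Rightarrow> nat \<Rightarrow> nat \<Rightarrow> real" where
  "H n l b g =
     fact n * fps_nth (fps_exp (real g) / (2 - fps_exp (real b)) ^ l) n"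

end

theory Submission
  imports Defs
begin

text \<open>
  Products of exponential generating functions count pairs of structures on complementary
  subsets. Removing the last section of a barred arrangement shows that its generating function
  is the product of those of its sections. Labellings by \<open>g\<close> labels have generating function
  $e^{gx}$. Removing the first block of a labelled preferential arrangement shows that the
  corresponding generating function satisfies $f = 1 + (e^{bx} - 1) f$, that is,
  $f = 1 / (2 - e^{bx})$.
\<close>

section \<open>Exponential generating functions of labelled structures\<close>

text \<open>Finiteness is part of the notion because \<open>card\<close> is 0 on infinite sets. The
  quantification over all finite sets lets inductions pass to complements such as
  \<open>X - A\<close>.\<close>

definition has_egf :: "('a set \<Rightarrow> 'b set) \<Rightarrow> real fps \<Rightarrow> bool" where
  "has_egf F f \<longleftrightarrow>
     (\<forall>A. finite A \<longrightarrow> finite (F A) \<and> real (card (F A)) = fact (card A) * fps_nth f (card A))"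

lemma has_egf_finite: "has_egf F f \<Longrightarrow> finite A \<Longrightarrow> finite (F A)"
  and has_egf_card:
    "has_egf F f \<Longrightarrow> finite A \<Longrightarrow> real (card (F A)) = fact (card A) * fps_nth f (card A)"
  by (auto simp: has_egf_def)

lemma sum_Pow_card:
  assumes "finite A"
  shows "(\<Sum>B\<in>Pow A. h (card B)) = (\<Sum>k\<le>card A. real (card A choose k) * h k)"
proof -
  have "(\<Sum>B\<in>Pow A. h (card B)) = (\<Sum>k\<le>card A. \<Sum>B\<in>{B\<in>Pow A. card B = k}. h (card B))"
    using assms by (intro sum.group [symmetric]) (auto intro: card_mono)
  also have "\<dots> = (\<Sum>k\<le>card A. real (card A choose k) * h k)"
    using n_subsets [OF assms] by (intro sum.cong) auto
  finally show ?thesis .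
qed

text \<open>The binomial coefficient that counts subsets of size \<open>k\<close> cancels the two
  factorials up to \<open>fact (card A)\<close>, and what remains is the Cauchy product.\<close>

lemma sum_Pow_egf_mult:
  fixes f g :: "real fps"
  assumes "finite A"
  shows "(\<Sum>B\<in>Pow A. fact (card B) * fps_nth f (card B) *
            (fact (card (A - B)) * fps_nth g (card (A - B))))
          = fact (card A) * fps_nth (f * g) (card A)"
proof -
  have "(\<Sum>B\<in>Pow A. fact (card B) * fps_nth f (card B) *
            (fact (card (A - B)) * fps_nth g (card (A - B))))
      = (\<Sum>B\<in>Pow A. fact (card B) * fps_nth f (card B) *
            (fact (card A - card B) * fps_nth g (card A - card B)))"
    using assms by (intro sum.cong) (auto simp: card_Diff_subset finite_subset)
  also have "\<dots> = (\<Sum>k\<le>card A. real (card A choose k) * (fact k * fps_nth f k *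
            (fact (card A - k) * fps_nth g (card A - k))))"
    by (rule sum_Pow_card [OF assms, where h = "\<lambda>k. fact k * fps_nth f k *
            (fact (card A - k) * fps_nth g (card A - k))"])
  also have "\<dots> = (\<Sum>k\<le>card A. fact (card A) * (fps_nth f k * fps_nth g (card A - k)))"
    by (intro sum.cong) (auto simp: binomial_fact)
  finally show ?thesis
    by (simp add: fps_mult_nth sum_distrib_left atLeast0AtMost)
qed

section \<open>Removing the last section\<close>

lemma barred_sections_0: "barred_sections 0 X = {[X]}"
  by (auto simp: barred_sections_def length_Suc_conv disjoint_family_on_def)

text \<open>The section is split off at the end because the first one carries a different kind of
  structure and must stay at index 0.\<close>

lemma barred_sections_snoc:
  "S @ [A] \<in> barred_sections (Suc k) X \<longleftrightarrow> A \<subseteq> X \<and> S \<in> barred_sections k (X - A)"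
proof (cases "length S = Suc k")
  case len: True
  have U: "\<Union>(set S) = (\<Union>i<Suc k. S ! i)"
    using len by (auto simp: set_conv_nth)
  have "disjoint_family_on (\<lambda>i. (S @ [A]) ! i) {..<Suc (Suc k)} \<longleftrightarrow>
      A \<inter> (\<Union>i<Suc k. (S @ [A]) ! i) = {} \<and>
      disjoint_family_on (\<lambda>i. (S @ [A]) ! i) {..<Suc k}"
    \<comment> \<open>Peeling off the top index \<open>Suc k\<close> separates \<open>A\<close> from
      the sections listed in \<open>S\<close>.\<close>
    using len by (subst lessThan_Suc, subst disjoint_family_on_insert) (auto simp: nth_append)
  also have "(\<Union>i<Suc k. (S @ [A]) ! i) = (\<Union>i<Suc k. S ! i)"
    using len by (intro SUP_cong) (auto simp: nth_append)
  also have "disjoint_family_on (\<lambda>i. (S @ [A]) ! i) {..<Suc k} \<longleftrightarrow>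
      disjoint_family_on (\<lambda>i. S ! i) {..<Suc k}"
    using len by (auto simp: disjoint_family_on_def nth_append)
  finally show ?thesis
    using len U by (auto simp: barred_sections_def)
qed (auto simp: barred_sections_def)

lemma barred_arrangements_0:
  "barred_arrangements F0 F 0 X = (\<lambda>s. ([X], s, [])) ` F0 X"
  by (auto simp: barred_arrangements_def barred_sections_0)

lemma barred_arrangements_snoc:
  "(S @ [A], s0, ss @ [s]) \<in> barred_arrangements F0 F (Suc k) X \<longleftrightarrow>
     A \<subseteq> X \<and> s \<in> F A \<and> (S, s0, ss) \<in> barred_arrangements F0 F k (X - A)"
proof (cases "length S = Suc k \<and> length ss = k")
  case True
  then have "(\<forall>i<Suc k. (ss @ [s]) ! i \<in> F ((S @ [A]) ! Suc i)) \<longleftrightarrow>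
      s \<in> F A \<and> (\<forall>i<k. ss ! i \<in> F (S ! Suc i))"
    by (auto simp: All_less_Suc nth_append)
  with True show ?thesis
    by (auto simp: barred_arrangements_def barred_sections_snoc nth_append)
next
  \<comment> \<open>With mismatched lengths both sides are false.\<close>
  case False
  then show ?thesis
    by (auto simp: barred_arrangements_def barred_sections_def)
qed

text \<open>The tuple is reordered so that the last section \<open>A\<close> comes first: the index
  set becomes a \<open>Sigma\<close> over \<open>A\<close> whose fibres are products, and the map is
  injective, so cardinalities can be summed.\<close>

lemma barred_arrangements_Suc:
  "barred_arrangements F0 F (Suc k) X =
     (\<lambda>(A, s, S, s0, ss). (S @ [A], s0, ss @ [s])) `
       (SIGMA A:Pow X. F A \<times> barred_arrangements F0 F k (X - A))" (is "?L = ?R")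
proof
  show "?L \<subseteq> ?R"
  proof
    fix t assume t: "t \<in> ?L"
    obtain T s0 ts where tt: "t = (T, s0, ts)"
      by (cases t)
    have "length T = Suc (Suc k)" "length ts = Suc k"
      using t tt by (auto simp: barred_arrangements_def barred_sections_def)
    then obtain S A ss s where "T = S @ [A]" "ts = ss @ [s]"
      by (metis length_Suc_conv_rev)
    with t tt show "t \<in> ?R"
      by (intro image_eqI [where x = "(A, s, S, s0, ss)"]) (simp_all add: barred_arrangements_snoc)
  qed
qed (auto simp: barred_arrangements_snoc)

lemma has_egf_barred_arrangements:
  assumes F0: "has_egf F0 f0" and F: "has_egf F f"
  shows "has_egf (barred_arrangements F0 F k) (f0 * f ^ k)"
proof (induction k)
  case 0
  show ?case
    using F0 by (auto simp: has_egf_def barred_arrangements_0 card_image inj_on_def)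
next
  case (Suc k)
  show ?case
    unfolding has_egf_def
  proof (intro allI impI)
    fix X :: "'a set" assume X: "finite X"
    let ?B = "\<lambda>A. F A \<times> barred_arrangements F0 F k (X - A)"
    have fin: "finite (?B A)" if "A \<in> Pow X" for A
      using that X has_egf_finite [OF F] has_egf_finite [OF Suc.IH]
      by (simp add: finite_subset)
    have "card (barred_arrangements F0 F (Suc k) X) = card (Sigma (Pow X) ?B)"
      unfolding barred_arrangements_Suc by (rule card_image) (auto simp: inj_on_def)
    also have "\<dots> = (\<Sum>A\<in>Pow X. card (?B A))"
      using X fin by (intro card_SigmaI) auto
    finally have "real (card (barred_arrangements F0 F (Suc k) X)) =
        (\<Sum>A\<in>Pow X. real (card (F A)) * real (card (barred_arrangements F0 F k (X - A))))"
      by (simp add: card_cartesian_product)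
    also have "\<dots> = (\<Sum>A\<in>Pow X. fact (card A) * fps_nth f (card A) *
           (fact (card (X - A)) * fps_nth (f0 * f ^ k) (card (X - A))))"
      using X by (intro sum.cong refl)
        (simp only: has_egf_card [OF F] has_egf_card [OF Suc.IH] finite_subset Pow_iff finite_Diff)
    also have "\<dots> = fact (card X) * fps_nth (f * (f0 * f ^ k)) (card X)"
      by (rule sum_Pow_egf_mult [OF X])
    finally have "real (card (barred_arrangements F0 F (Suc k) X)) =
        fact (card X) * fps_nth (f0 * f ^ Suc k) (card X)"
      by (simp only: power_Suc mult.left_commute)
    moreover have "finite (barred_arrangements F0 F (Suc k) X)"
      unfolding barred_arrangements_Suc using X by (intro finite_imageI finite_SigmaI [OF _ fin]) (simp_all only: finite_Pow_iff)
    ultimately show "finite (barred_arrangements F0 F (Suc k) X) \<and>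
        real (card (barred_arrangements F0 F (Suc k) X)) =
        fact (card X) * fps_nth (f0 * f ^ Suc k) (card X)"
      by blast
  qed
qed

section \<open>Removing the first block of a preferential arrangement\<close>

lemma preferential_arrangements_empty: "preferential_arrangements {} = {[]}"
  by (auto simp: preferential_arrangements_def partition_on_empty)

lemma Cons_in_preferential_arrangements_iff:
  "B # bs \<in> preferential_arrangements A \<longleftrightarrow>
     B \<noteq> {} \<and> B \<subseteq> A \<and> bs \<in> preferential_arrangements (A - B)"
proof
  assume "B # bs \<in> preferential_arrangements A"
  then have bs: "B \<notin> set bs" "distinct bs" and P: "partition_on A (insert B (set bs))"
    by (simp_all add: preferential_arrangements_def)
  \<comment> \<open>Distinctness of the list gives \<open>B\<close> different from \<open>C\<close>,
    which disjointness of the family requires.\<close>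
  have "B \<inter> C = {}" if "C \<in> set bs" for C
    using partition_onD2 [OF P] bs(1) that by (auto dest: disjointD)
  then have "disjnt B (\<Union>(set bs))"
    by (auto simp: disjnt_def)
  with bs P show "B \<noteq> {} \<and> B \<subseteq> A \<and> bs \<in> preferential_arrangements (A - B)"
    by (simp add: preferential_arrangements_def partition_on_insert)
next
  assume "B \<noteq> {} \<and> B \<subseteq> A \<and> bs \<in> preferential_arrangements (A - B)"
  then have B: "B \<noteq> {}" "B \<subseteq> A" and "distinct bs" and P: "partition_on (A - B) (set bs)"
    by (simp_all add: preferential_arrangements_def)
  have d: "disjnt B (\<Union>(set bs))"
    using partition_onD1 [OF P] by (auto simp: disjnt_def)
  \<comment> \<open>A nonempty set disjoint from all blocks in \<open>bs\<close> cannot be one of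
    them.\<close>
  with B have "B \<notin> set bs"
    by (auto simp: disjnt_def)
  with B d P \<open>distinct bs\<close> show "B # bs \<in> preferential_arrangements A"
    by (simp add: preferential_arrangements_def partition_on_insert)
qed

text \<open>The empty set is excluded because its only arrangement \<open>[]\<close> has no first
  block; that arrangement accounts for the summand 1 in the equation for the generating
  function.\<close>

lemma preferential_arrangements_rec:
  assumes "A \<noteq> {}"
  shows "preferential_arrangements A =
    (\<lambda>(B, bs). B # bs) ` (SIGMA B:Pow A - {{}}. preferential_arrangements (A - B))" (is "?L = ?R")
proof
  show "?L \<subseteq> ?R"
  proof
    fix cs assume cs: "cs \<in> ?L"
    then have "cs \<noteq> []"
      using assms by (auto simp: preferential_arrangements_def partition_on_def)
    with cs show "cs \<in> ?R"
      by (cases cs) (force simp: Cons_in_preferential_arrangements_iff)+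
  qed
qed (auto simp: Cons_in_preferential_arrangements_iff)

lemma finite_preferential_arrangements:
  assumes "finite A"
  shows "finite (preferential_arrangements A)"
proof (rule finite_subset)
  show "preferential_arrangements A \<subseteq> {bs. set bs \<subseteq> Pow A \<and> distinct bs}"
    by (auto simp: preferential_arrangements_def partition_on_def)
qed (use assms in \<open>simp add: finite_subset_distinct\<close>)

lemma card_preferential_arrangements_rec:
  assumes "finite A" "A \<noteq> {}"
  shows "card (preferential_arrangements A) =
    (\<Sum>B\<in>Pow A - {{}}. card (preferential_arrangements (A - B)))"
proof -
  have "card (preferential_arrangements A) =
      card (SIGMA B:Pow A - {{}}. preferential_arrangements (A - B))"
    unfolding preferential_arrangements_rec [OF assms(2)]
    by (rule card_image) (auto simp: inj_on_def)
  also have "\<dots> = (\<Sum>B\<in>Pow A - {{}}. card (preferential_arrangements (A - B)))"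
    using assms by (intro card_SigmaI) (auto simp: finite_preferential_arrangements)
  finally show ?thesis .
qed

section \<open>Labellings and labelled preferential arrangements\<close>

lemma has_egf_compartment_labellings:
  "has_egf (compartment_labellings m) (fps_exp (real m))"
  by (auto simp: has_egf_def compartment_labellings_def card_PiE finite_PiE)

lemma card_labelled_preferential_arrangements:
  "finite A \<Longrightarrow> card (labelled_preferential_arrangements m A) =
    card (preferential_arrangements A) * m ^ card A"
  by (simp add: labelled_preferential_arrangements_def compartment_labellings_def
      card_cartesian_product card_PiE)

text \<open>A labelling of \<open>A\<close> splits into one of the first block \<open>B\<close> and
  one of \<open>A - B\<close>, which turns the factor \<open>m ^ card A\<close> into a
  product.\<close>

lemma card_labelled_preferential_arrangements_rec:
  assumes "finite A" "A \<noteq> {}"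
  shows "card (labelled_preferential_arrangements m A) =
    (\<Sum>B\<in>Pow A - {{}}. m ^ card B * card (labelled_preferential_arrangements m (A - B)))"
proof -
  have "m ^ card A = m ^ card B * m ^ card (A - B)" if "B \<subseteq> A" for B
    using that assms(1)
    by (metis card_Diff_subset card_mono finite_subset le_add_diff_inverse power_add)
  then have "(\<Sum>B\<in>Pow A - {{}}. card (preferential_arrangements (A - B)) * m ^ card A) =
      (\<Sum>B\<in>Pow A - {{}}. m ^ card B * (card (preferential_arrangements (A - B)) * m ^ card (A - B)))"
    by (intro sum.cong refl) (metis DiffD1 PowD mult.left_commute)
  with assms show ?thesis
    by (simp add: card_labelled_preferential_arrangements card_preferential_arrangements_rec
        sum_distrib_right)
qed

lemma has_egf_labelled_preferential_arrangements:
  "has_egf (labelled_preferential_arrangements m) (inverse (2 - fps_exp (real m)))"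
  unfolding has_egf_def
proof (intro allI impI conjI)
  fix A :: "'a set" assume "finite A"
  then show "finite (labelled_preferential_arrangements m A)"
    by (simp add: labelled_preferential_arrangements_def compartment_labellings_def
        finite_preferential_arrangements finite_PiE)
  let ?e = "fps_exp (real m)"
  define f where "f = inverse (2 - ?e)"
  have "fps_nth (2 - ?e) 0 \<noteq> 0"
    by (simp add: fps_numeral_nth_0)
  then have "f * (2 - ?e) = 1"
    unfolding f_def by (rule inverse_mult_eq_1)
  \<comment> \<open>Since \<open>?e - 1\<close> has constant coefficient 0, this form determines
    each coefficient of \<open>f\<close> from lower ones, matching the recursion on the first
    block.\<close>
  then have f: "f = 1 + (?e - 1) * f"
    by (simp add: algebra_simps)
  show "real (card (labelled_preferential_arrangements m A)) = fact (card A) * fps_nth f (card A)"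
    using \<open>finite A\<close>
  proof (induction A rule: finite_psubset_induct)
    case (psubset A)
    show ?case
    proof (cases "A = {}")
      case True
      have "fps_nth f 0 = 1"
        by (subst f) simp
      with True show ?thesis
        by (simp add: card_labelled_preferential_arrangements preferential_arrangements_empty)
    next
      case False
      have "real (card (labelled_preferential_arrangements m A)) =
          (\<Sum>B\<in>Pow A - {{}}. real m ^ card B *
             real (card (labelled_preferential_arrangements m (A - B))))"
        using psubset.hyps False by (simp add: card_labelled_preferential_arrangements_rec)
      also have "\<dots> = (\<Sum>B\<in>Pow A - {{}}. fact (card B) * fps_nth (?e - 1) (card B) *
             (fact (card (A - B)) * fps_nth f (card (A - B))))"
      proof (intro sum.cong refl)
        fix B assume B: "B \<in> Pow A - {{}}"
        \<comment> \<open>The coefficients of \<open>?e - 1\<close> and \<open>?e\<close> agree only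
          away from index 0, so nonemptiness of \<open>B\<close> matters here.\<close>
        then have "card B \<noteq> 0" "A - B \<subset> A"
          using psubset.hyps by (auto simp: finite_subset card_eq_0_iff)
        then show "real m ^ card B * real (card (labelled_preferential_arrangements m (A - B))) =
            fact (card B) * fps_nth (?e - 1) (card B) *
             (fact (card (A - B)) * fps_nth f (card (A - B)))"
          using psubset.IH by simp
      qed
      \<comment> \<open>The empty block may be added, as its term carries the constant coefficient 0
        of \<open>?e - 1\<close>.\<close>
      also have "\<dots> = (\<Sum>B\<in>Pow A. fact (card B) * fps_nth (?e - 1) (card B) *
             (fact (card (A - B)) * fps_nth f (card (A - B))))"
        using psubset.hyps by (intro sum.mono_neutral_left) auto
      also have "\<dots> = fact (card A) * fps_nth ((?e - 1) * f) (card A)"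
        by (rule sum_Pow_egf_mult [OF psubset.hyps])
      \<comment> \<open>The summand 1 in \<open>f\<close> affects only the constant coefficient, and
        \<open>card A\<close> is positive. Only the occurrence of \<open>f\<close> on the right is
        unfolded.\<close>
      also have "fps_nth ((?e - 1) * f) (card A) = fps_nth f (card A)"
        using False psubset.hyps by (subst (2) f) simp
      finally show ?thesis .
    qed
  qed
qed

theorem theorem6:
  fixes l b g n :: nat
  assumes "(l, g) \<noteq> (0, 0)" and "b > 0"
  shows "H n l b g = real (card (labelled_barred_preferential_arrangements l b g {1..n}))"
proof -
  let ?e = "fps_exp (real b)"
  \<comment> \<open>The constant coefficient is 1, so the quotient becomes a product with an
    inverse, the form \<open>f0 * f ^ k\<close> obtained for barred arrangements.\<close>
  have "fps_nth ((2 - ?e) ^ l) 0 \<noteq> 0"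
    by (simp add: fps_nth_power_0 fps_numeral_nth_0)
  then have "fps_exp (real g) / (2 - ?e) ^ l = fps_exp (real g) * inverse (2 - ?e) ^ l"
    by (simp add: fps_divide_unit fps_inverse_power)
  then show ?thesis
    using has_egf_card [OF has_egf_barred_arrangements [OF has_egf_compartment_labellings
        has_egf_labelled_preferential_arrangements], of "{1..n}" g b l]
    by (simp add: H_def labelled_barred_preferential_arrangements_def)
qed

end
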